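(* Let $M$ be a $2$-dimensional pseudo-Riemannian quadric in its ambient $3$-dimensional pseudo-Euclidean space $\mathbb{V}$, and let $\sigma$ be a Killing field on $M$ whose linear extension $A$ has the following matrix with respect to an orthonormal frame of $\mathbb{V}$: $$\begin{pmatrix}0&a&b\\-\epsilon_1\epsilon_2a&0&c\\-\epsilon_1\epsilon_3b&-\epsilon_2\epsilon_3c&0\end{pmatrix},$$ where $a,b,c\in\mathbb{R}$ and $\epsilon_1,\epsilon_2,\epsilon_3\in\{\pm1\}$ are the indicator symbols of the frame. Then $\sigma$ is preharmonic, and $\hat\sigma=\lambda\sigma$ with $$\lambda=-\epsilon_1\epsilon_2a^2-\epsilon_1\epsilon_3b^2-\epsilon_2\epsilon_3c^2 .$$
   Context: $\mathbb{R}^3_u$ denotes $\mathbb{R}^3$ with the standard diagonal inner product of index $u$ (the last $u$ coordinates carry minus signs). The pseudo-Riemannian quadrics are $S^2_v=\{x\in\mathbb{R}^3_v:\langle x,x\rangle=1\}$ and $H^2_v=\{x\in\mathbb{R}^3_{v+1}:\langle x,x\rangle=-1\}$, $v=0,1,2$, with induced metrics; $\mathbb{V}$ denotes the ambient space. The indicator symbols of an orthonormal frame $\{e_i\}$ are $\epsilon_i=\langle e_i,e_i\rangle=\pm1$. Each Killing field $\sigma$ on $M$ is the restriction to $M$ of a unique skew-symmetric linear map $A\colon\mathbb{V}\to\mathbb{V}$, its linear extension; $\hat\sigma$ denotes the Killing field with linear extension $A^3$. With $F=\frac12\langle\sigma,\sigma\rangle$, $\nabla F=\operatorname{grad}F$,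 $\nabla$ the Levi-Civita connection, and $\nabla^*\nabla\sigma=-\operatorname{trace}\nabla^2\sigma$ the rough Laplacian, a vector field $\sigma$ is preharmonic if there exist smooth functions $\nu,\zeta\colon M\to\mathbb{R}$ with $\nabla^*\nabla\sigma=\nu\sigma$ and $\nabla_{\nabla F}\sigma=\zeta\sigma$. *)

theory Defs
  imports "HOL-Analysis.Analysis"
begin

type_synonym vec3 = "real^3"

text \<open>The inner product of index \<open>u\<close> on \<open>\<real>\<^sup>3\<close>: the last \<open>u\<close> coordinates carry a minus sign.\<close>

definition pinner :: "nat \<Rightarrow> vec3 \<Rightarrow> vec3 \<Rightarrow> real" where
  "pinner u x y =
     (if 3 \<le> u then -1 else 1) * x$1 * y$1 +
     (if 2 \<le> u then -1 else 1) * x$2 * y$2 +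
     (if 1 \<le> u then -1 else 1) * x$3 * y$3"

definition pseudo_sphere :: "nat \<Rightarrow> vec3 set" where
  "pseudo_sphere v = {x. pinner v x x = 1}"

definition pseudo_hyperbolic :: "nat \<Rightarrow> vec3 set" where
  "pseudo_hyperbolic v = {x. pinner (v + 1) x x = -1}"

text \<open>\<open>quadric u M\<close>: \<open>M\<close> is a quadric whose ambient space is \<open>\<real>\<^sup>3\<close> with index \<open>u\<close>.\<close>

definition quadric :: "nat \<Rightarrow> vec3 set \<Rightarrow> bool" where
  "quadric u M \<longleftrightarrow>
     (\<exists>v\<le>2. (u = v \<and> M = pseudo_sphere v) \<or> (u = v + 1 \<and> M = pseudo_hyperbolic v))"

text \<open>Functions and vector fields on \<open>M\<close> are represented by functions on the whole ambient space
  of which only the values on \<open>M\<close> matter.\<close>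

primrec Ck_on :: "nat \<Rightarrow> 'a set \<Rightarrow> ('a::real_normed_vector \<Rightarrow> 'b::real_normed_vector) \<Rightarrow> bool" where
  "Ck_on 0 U f \<longleftrightarrow> continuous_on U f"
| "Ck_on (Suc k) U f \<longleftrightarrow>
     (\<forall>x\<in>U. f differentiable (at x)) \<and>
     (\<forall>v. Ck_on k U (\<lambda>x. frechet_derivative f (at x) v))"

definition smooth_fun :: "vec3 set \<Rightarrow> (vec3 \<Rightarrow> 'b::real_normed_vector) \<Rightarrow> bool" where
  "smooth_fun M f \<longleftrightarrow>
     (\<forall>p\<in>M. \<exists>U g. open U \<and> p \<in> U \<and> (\<forall>k. Ck_on k U g) \<and> (\<forall>x\<in>U \<inter> M. g x = f x))"

definition tangent_space :: "vec3 set \<Rightarrow> vec3 \<Rightarrow> vec3 set" where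
  "tangent_space M p =
     {v. \<exists>\<gamma>. \<gamma> 0 = p \<and> (\<forall>t::real. \<gamma> t \<in> M) \<and> (\<gamma> has_vector_derivative v) (at 0)}"

definition vector_field :: "vec3 set \<Rightarrow> (vec3 \<Rightarrow> vec3) \<Rightarrow> bool" where
  "vector_field M X \<longleftrightarrow> smooth_fun M X \<and> (\<forall>p\<in>M. X p \<in> tangent_space M p)"

text \<open>The differential of \<open>f\<close> at \<open>p \<in> M\<close>. A derivative within \<open>M\<close> is determined only on
  \<open>tangent_space M p\<close>, so \<open>v\<close> must be tangent to \<open>M\<close>; it is in all uses below.\<close>

definition dM :: "vec3 set \<Rightarrow> (vec3 \<Rightarrow> 'b::real_normed_vector) \<Rightarrow> vec3 \<Rightarrow> vec3 \<Rightarrow> 'b" where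
  "dM M f p v = frechet_derivative f (at p within M) v"

text \<open>On the ambient coordinate functions \<open>x\<^sub>i\<close> this is \<open>X(Y x\<^sub>i) - Y(X x\<^sub>i)\<close>, since
  \<open>X x\<^sub>i\<close> is the \<open>i\<close>-th component of \<open>X\<close>.\<close>

definition lie_bracket :: "vec3 set \<Rightarrow> (vec3 \<Rightarrow> vec3) \<Rightarrow> (vec3 \<Rightarrow> vec3) \<Rightarrow> vec3 \<Rightarrow> vec3" where
  "lie_bracket M X Y p = dM M Y p (X p) - dM M X p (Y p)"

definition affine_connection ::
  "vec3 set \<Rightarrow> ((vec3 \<Rightarrow> vec3) \<Rightarrow> (vec3 \<Rightarrow> vec3) \<Rightarrow> vec3 \<Rightarrow> vec3) \<Rightarrow> bool" where
  "affine_connection M D \<longleftrightarrow>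
     (\<forall>X Y. vector_field M X \<longrightarrow> vector_field M Y \<longrightarrow> vector_field M (D X Y)) \<and>
     (\<forall>X X' Y. vector_field M X \<longrightarrow> vector_field M X' \<longrightarrow> vector_field M Y \<longrightarrow>
        (\<forall>p\<in>M. D (\<lambda>q. X q + X' q) Y p = D X Y p + D X' Y p)) \<and>
     (\<forall>f X Y. smooth_fun M (f :: vec3 \<Rightarrow> real) \<longrightarrow> vector_field M X \<longrightarrow> vector_field M Y \<longrightarrow>
        (\<forall>p\<in>M. D (\<lambda>q. f q *\<^sub>R X q) Y p = f p *\<^sub>R D X Y p)) \<and>
     (\<forall>X Y Y'. vector_field M X \<longrightarrow> vector_field M Y \<longrightarrow> vector_field M Y' \<longrightarrow>
        (\<forall>p\<in>M. D X (\<lambda>q. Y q + Y' q) p = D X Y p + D X Y' p)) \<and>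
     (\<forall>f X Y. smooth_fun M (f :: vec3 \<Rightarrow> real) \<longrightarrow> vector_field M X \<longrightarrow> vector_field M Y \<longrightarrow>
        (\<forall>p\<in>M. D X (\<lambda>q. f q *\<^sub>R Y q) p = f p *\<^sub>R D X Y p + dM M f p (X p) *\<^sub>R Y p))"

definition torsion_free ::
  "vec3 set \<Rightarrow> ((vec3 \<Rightarrow> vec3) \<Rightarrow> (vec3 \<Rightarrow> vec3) \<Rightarrow> vec3 \<Rightarrow> vec3) \<Rightarrow> bool" where
  "torsion_free M D \<longleftrightarrow>
     (\<forall>X Y. vector_field M X \<longrightarrow> vector_field M Y \<longrightarrow>
        (\<forall>p\<in>M. D X Y p - D Y X p = lie_bracket M X Y p))"

definition metric_connection ::
  "nat \<Rightarrow> vec3 set \<Rightarrow> ((vec3 \<Rightarrow> vec3) \<Rightarrow> (vec3 \<Rightarrow> vec3) \<Rightarrow> vec3 \<Rightarrow> vec3) \<Rightarrow> bool" where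
  "metric_connection u M D \<longleftrightarrow>
     (\<forall>X Y Z. vector_field M X \<longrightarrow> vector_field M Y \<longrightarrow> vector_field M Z \<longrightarrow>
        (\<forall>p\<in>M. dM M (\<lambda>q. pinner u (Y q) (Z q)) p (X p) =
                pinner u (D X Y p) (Z p) + pinner u (Y p) (D X Z p)))"

definition levi_civita ::
  "nat \<Rightarrow> vec3 set \<Rightarrow> ((vec3 \<Rightarrow> vec3) \<Rightarrow> (vec3 \<Rightarrow> vec3) \<Rightarrow> vec3 \<Rightarrow> vec3) \<Rightarrow> bool" where
  "levi_civita u M D \<longleftrightarrow>
     affine_connection M D \<and> torsion_free M D \<and> metric_connection u M D"

text \<open>The choice is immaterial: two such operators agree at the points of \<open>M\<close> on vector fields
  on \<open>M\<close>.\<close>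

definition nabla ::
  "nat \<Rightarrow> vec3 set \<Rightarrow> (vec3 \<Rightarrow> vec3) \<Rightarrow> (vec3 \<Rightarrow> vec3) \<Rightarrow> vec3 \<Rightarrow> vec3" where
  "nabla u M = (SOME D. levi_civita u M D)"

definition grad :: "nat \<Rightarrow> vec3 set \<Rightarrow> (vec3 \<Rightarrow> real) \<Rightarrow> vec3 \<Rightarrow> vec3" where
  "grad u M f p =
     (THE w. w \<in> tangent_space M p \<and> (\<forall>v\<in>tangent_space M p. pinner u w v = dM M f p v))"

text \<open>\<open>nabla2 u M X Y \<sigma>\<close> is \<open>\<nabla>\<^sup>2\<sigma>(X,Y)\<close>.\<close>

definition nabla2 ::
  "nat \<Rightarrow> vec3 set \<Rightarrow> (vec3 \<Rightarrow> vec3) \<Rightarrow> (vec3 \<Rightarrow> vec3) \<Rightarrow> (vec3 \<Rightarrow> vec3) \<Rightarrow> vec3 \<Rightarrow> vec3" where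
  "nabla2 u M X Y \<sigma> p = nabla u M X (nabla u M Y \<sigma>) p - nabla u M (nabla u M X Y) \<sigma> p"

text \<open>\<open>nabla2\<close> is tensorial in \<open>X\<close>, \<open>Y\<close>, so the metric trace at \<open>p\<close> can be computed from any two
  global fields that are orthonormal at the single point \<open>p\<close>; these span the tangent space because
  \<open>M\<close> is 2-dimensional. Fields orthonormal everywhere need not exist.\<close>

definition orthonormal_at :: "nat \<Rightarrow> vec3 set \<Rightarrow> vec3 \<Rightarrow> (vec3 \<Rightarrow> vec3) \<Rightarrow> (vec3 \<Rightarrow> vec3) \<Rightarrow> bool" where
  "orthonormal_at u M p X Y \<longleftrightarrow> vector_field M X \<and> vector_field M Y \<and>
     pinner u (X p) (X p) \<in> {1, -1} \<and> pinner u (Y p) (Y p) \<in> {1, -1} \<and> pinner u (X p) (Y p) = 0"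

definition trace_nabla2 :: "nat \<Rightarrow> vec3 set \<Rightarrow> (vec3 \<Rightarrow> vec3) \<Rightarrow> vec3 \<Rightarrow> vec3" where
  "trace_nabla2 u M \<sigma> p =
     (THE w. \<exists>X Y. orthonormal_at u M p X Y \<and>
        w = pinner u (X p) (X p) *\<^sub>R nabla2 u M X X \<sigma> p
          + pinner u (Y p) (Y p) *\<^sub>R nabla2 u M Y Y \<sigma> p)"

definition rough_laplacian :: "nat \<Rightarrow> vec3 set \<Rightarrow> (vec3 \<Rightarrow> vec3) \<Rightarrow> vec3 \<Rightarrow> vec3" where
  "rough_laplacian u M \<sigma> p = - trace_nabla2 u M \<sigma> p"

definition preharmonic :: "nat \<Rightarrow> vec3 set \<Rightarrow> (vec3 \<Rightarrow> vec3) \<Rightarrow> bool" where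
  "preharmonic u M \<sigma> \<longleftrightarrow> vector_field M \<sigma> \<and>
     (let F = (\<lambda>q. 1/2 * pinner u (\<sigma> q) (\<sigma> q)) in
      \<exists>\<nu> \<zeta> :: vec3 \<Rightarrow> real. smooth_fun M \<nu> \<and> smooth_fun M \<zeta> \<and>
        (\<forall>p\<in>M. rough_laplacian u M \<sigma> p = \<nu> p *\<^sub>R \<sigma> p) \<and>
        (\<forall>p\<in>M. nabla u M (grad u M F) \<sigma> p = \<zeta> p *\<^sub>R \<sigma> p))"

text \<open>Vanishing of the Lie derivative of the metric along \<open>\<sigma>\<close>.\<close>

definition killing_field :: "nat \<Rightarrow> vec3 set \<Rightarrow> (vec3 \<Rightarrow> vec3) \<Rightarrow> bool" where
  "killing_field u M \<sigma> \<longleftrightarrow> vector_field M \<sigma> \<and>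
     (\<forall>X Y. vector_field M X \<longrightarrow> vector_field M Y \<longrightarrow>
        (\<forall>p\<in>M. dM M (\<lambda>q. pinner u (X q) (Y q)) p (\<sigma> p) =
                pinner u (lie_bracket M \<sigma> X p) (Y p) + pinner u (X p) (lie_bracket M \<sigma> Y p)))"

definition linear_extension :: "nat \<Rightarrow> vec3 set \<Rightarrow> (vec3 \<Rightarrow> vec3) \<Rightarrow> (vec3 \<Rightarrow> vec3) \<Rightarrow> bool" where
  "linear_extension u M \<sigma> A \<longleftrightarrow>
     linear A \<and> (\<forall>x y. pinner u (A x) y = - pinner u x (A y)) \<and> (\<forall>x\<in>M. \<sigma> x = A x)"

text \<open>\<open>M\<close> spans \<open>\<real>\<^sup>3\<close>, so a linear extension is unique.\<close>

definition hat_field :: "nat \<Rightarrow> vec3 set \<Rightarrow> (vec3 \<Rightarrow> vec3) \<Rightarrow> vec3 \<Rightarrow> vec3" where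
  "hat_field u M \<sigma> = (THE A. linear_extension u M \<sigma> A) ^^ 3"

definition orthonormal_frame :: "nat \<Rightarrow> (3 \<Rightarrow> vec3) \<Rightarrow> bool" where
  "orthonormal_frame u e \<longleftrightarrow>
     (\<forall>i. pinner u (e i) (e i) \<in> {1, -1}) \<and> (\<forall>i j. i \<noteq> j \<longrightarrow> pinner u (e i) (e j) = 0)"

definition has_matrix :: "(3 \<Rightarrow> vec3) \<Rightarrow> (vec3 \<Rightarrow> vec3) \<Rightarrow> real^3^3 \<Rightarrow> bool" where
  "has_matrix e A N \<longleftrightarrow> (\<forall>j. A (e j) = (\<Sum>i\<in>UNIV. N $ i $ j *\<^sub>R e i))"

end

theory Submission
  imports Defs
begin

text \<open>Write a quadric as \<open>M = {p. \<langle>p, p\<rangle> = s}\<close> with \<open>s = \<plusminus>1\<close>. The position vector \<open>p\<close> is then a unit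
  normal, the tangent space at \<open>p\<close> is the orthogonal complement of \<open>p\<close>, and the Levi-Civita
  connection is the tangential part of the ambient derivative,
  \<open>\<nabla>\<^sub>X Y = dY(X) + s \<langle>X, Y\<rangle> p\<close> (\<open>levi_civita_tangential_derivative\<close>). By the Koszul formula any
  other Levi-Civita connection agrees with it on \<open>M\<close>, so this formula computes \<open>nabla\<close>
  (\<open>nabla_eq\<close>).

  For a field \<open>\<sigma>\<close> with skew-symmetric linear extension \<open>A\<close> everything becomes explicit. At a point
  \<open>p\<close> and for a tangent vector \<open>x\<close>, \<open>\<nabla>\<^sub>x \<sigma> = A x + s \<langle>x, A p\<rangle> p\<close> and
  \<open>\<nabla>\<^sup>2\<sigma>(x, x) = s \<langle>x, A p\<rangle> x - s \<langle>x, x\<rangle> A p\<close> (\<open>nabla2_\<sigma>\<close>). In dimension two the trace of the latter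
  is \<open>s A p - 2 s A p\<close>, so \<open>\<nabla>\<^sup>*\<nabla>\<sigma> = s \<sigma>\<close>. Moreover \<open>\<nabla>F = - A\<^sup>2 p - s \<langle>A p, A p\<rangle> p\<close>, which is
  orthogonal to \<open>A p\<close>, so \<open>\<nabla>\<sigma>\<close> in this direction is \<open>- A\<^sup>3 p - s \<langle>A p, A p\<rangle> A p\<close>. The Cayley--Hamilton
  theorem gives \<open>A\<^sup>3 = \<lambda> A\<close> (\<open>skew_matrix_cube\<close>), whence \<open>\<zeta> = - \<lambda> - s \<langle>A p, A p\<rangle>\<close>. The same identity
  is the claim about \<open>hat_field\<close>, because \<open>A\<close> is the only linear extension of \<open>\<sigma>\<close>.

  Smoothness is a condition on local ambient extensions, so that the covariant derivative of smooth
  fields is smooth needs the closure of the classes C^k under products and directional derivatives.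
  Differentials on \<open>M\<close> are controlled only in tangent directions, where the chain rule along curves
  determines them (\<open>dM_eq\<close>).\<close>

section \<open>Maps of class C^k\<close>

lemma Ck_on_subset: "Ck_on k U f \<Longrightarrow> V \<subseteq> U \<Longrightarrow> Ck_on k V f"
  by (induction k arbitrary: f) (auto intro: continuous_on_subset)

lemma Ck_on_Suc_derivative:
  "Ck_on (Suc k) U f \<Longrightarrow> Ck_on k U (\<lambda>x. frechet_derivative f (at x) v)"
  by simp

lemma Ck_on_lower: "Ck_on (Suc k) U f \<Longrightarrow> Ck_on k U f"
proof (induction k arbitrary: f)
  case 0
  then have "f differentiable (at x)" if "x \<in> U" for x
    using that by simp
  then have "continuous (at x) f" if "x \<in> U" for x
    using that differentiable_imp_continuous_within by blast
  then show ?case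
    by (simp add: continuous_at_imp_continuous_on)
next
  case (Suc k)
  have d: "f differentiable (at x)" if "x \<in> U" for x
    using Suc.prems that by simp
  have "Ck_on k U (\<lambda>x. frechet_derivative f (at x) v)" for v
    by (rule Suc.IH, rule Ck_on_Suc_derivative, rule Suc.prems)
  with d show ?case
    by simp
qed

lemma Ck_on_cong:
  assumes "open U" "Ck_on k U f" "\<And>x. x \<in> U \<Longrightarrow> f x = g x"
  shows "Ck_on k U g"
  using assms(2,3)
proof (induction k arbitrary: f g)
  case 0
  then show ?case
    by (metis Ck_on.simps(1) continuous_on_cong)
next
  case (Suc k)
  have g: "(g has_derivative frechet_derivative f (at x)) (at x)" if "x \<in> U" for x
  proof (rule has_derivative_transform_within_open)
    show "(f has_derivative frechet_derivative f (at x)) (at x)"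
      using Suc.prems(1) that by (simp flip: frechet_derivative_works)
  qed (use assms(1) that Suc.prems(2) in auto)
  have "Ck_on k U (\<lambda>x. frechet_derivative g (at x) v)" for v
  proof (rule Suc.IH)
    show "Ck_on k U (\<lambda>x. frechet_derivative f (at x) v)"
      using Suc.prems by simp
    show "frechet_derivative f (at x) v = frechet_derivative g (at x) v" if "x \<in> U" for x
      using frechet_derivative_at[OF g[OF that]] by simp
  qed
  then show ?case
    using g by (auto simp: differentiable_def)
qed

lemma Ck_on_SucI:
  assumes "open U" and "\<And>x. x \<in> U \<Longrightarrow> (f has_derivative f' x) (at x)"
    and "\<And>v. Ck_on k U (\<lambda>x. f' x v)"
  shows "Ck_on (Suc k) U f"
proof -
  have "Ck_on k U (\<lambda>x. frechet_derivative f (at x) v)" for v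
    using assms(1) assms(3)[of v]
    by (rule Ck_on_cong) (use frechet_derivative_at[OF assms(2)] in simp)
  then show ?thesis
    using assms(2) by (auto simp: differentiable_def)
qed

lemma Ck_on_has_derivative:
  "Ck_on (Suc k) U f \<Longrightarrow> x \<in> U \<Longrightarrow> (f has_derivative frechet_derivative f (at x)) (at x)"
  by (simp flip: frechet_derivative_works)

lemma Ck_on_const: "open U \<Longrightarrow> Ck_on k U (\<lambda>x. c)"
  by (induction k arbitrary: c) simp_all

lemma Ck_on_linear:
  assumes "open U" "bounded_linear L"
  shows "Ck_on k U L"
proof (cases k)
  case 0
  then show ?thesis
    using assms by (simp add: linear_continuous_on)
next
  case (Suc k')
  have "Ck_on (Suc k') U L"
    by (rule Ck_on_SucI[where f' = "\<lambda>x. L"])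
      (use assms in \<open>simp_all add: bounded_linear_imp_has_derivative Ck_on_const\<close>)
  then show ?thesis
    using Suc by simp
qed

lemma Ck_on_add:
  assumes "open U" "Ck_on k U f" "Ck_on k U g"
  shows "Ck_on k U (\<lambda>x. f x + g x)"
  using assms(2,3)
proof (induction k arbitrary: f g)
  case 0
  then show ?case by (simp add: continuous_on_add)
next
  case (Suc k)
  show ?case
  proof (rule Ck_on_SucI[OF assms(1)])
    show "((\<lambda>x. f x + g x) has_derivative
        (\<lambda>v. frechet_derivative f (at x) v + frechet_derivative g (at x) v)) (at x)"
      if "x \<in> U" for x
      using Suc.prems that by (intro has_derivative_add Ck_on_has_derivative)
  qed (use Suc in simp)
qed

lemma Ck_on_sum:
  assumes "open U" "\<And>i. i \<in> I \<Longrightarrow> Ck_on k U (f i)"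
  shows "Ck_on k U (\<lambda>x. \<Sum>i\<in>I. f i x)"
  using assms(2)
  by (induction I rule: infinite_finite_induct) (simp_all add: assms(1) Ck_on_const Ck_on_add)

text \<open>The Leibniz rule expresses the derivative of a product by products of maps that have one
  degree of smoothness less, so induction on the degree applies.\<close>

lemma Ck_on_bilinear:
  assumes "open U" "bounded_bilinear B" "Ck_on k U f" "Ck_on k U g"
  shows "Ck_on k U (\<lambda>x. B (f x) (g x))"
  using assms(3,4)
proof (induction k arbitrary: f g)
  case 0
  then show ?case
    using assms(2) by (simp add: bounded_bilinear.continuous_on)
next
  case (Suc k)
  show ?case
  proof (rule Ck_on_SucI[OF assms(1)])
    show "((\<lambda>x. B (f x) (g x)) has_derivative
        (\<lambda>v. B (f x) (frechet_derivative g (at x) v) + B (frechet_derivative f (at x) v) (g x))) (at x)"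
      if "x \<in> U" for x
      using Suc.prems that assms(2) by (intro bounded_bilinear.FDERIV Ck_on_has_derivative)
    show "Ck_on k U (\<lambda>x. B (f x) (frechet_derivative g (at x) v)
        + B (frechet_derivative f (at x) v) (g x))" for v
      using Suc.prems Ck_on_lower[OF Suc.prems(1)] Ck_on_lower[OF Suc.prems(2)]
      by (intro Ck_on_add assms(1) Suc.IH) auto
  qed
qed

lemma Ck_on_directional_derivative:
  fixes f :: "'a::euclidean_space \<Rightarrow> 'b::real_normed_vector"
  assumes "open U" "Ck_on (Suc k) U f" "Ck_on k U X"
  shows "Ck_on k U (\<lambda>x. frechet_derivative f (at x) (X x))"
proof (rule Ck_on_cong[OF assms(1)])
  show "Ck_on k U (\<lambda>x. \<Sum>b\<in>Basis. (X x \<bullet> b) *\<^sub>R frechet_derivative f (at x) b)"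
    using assms
    by (intro Ck_on_sum Ck_on_bilinear[OF _ bounded_bilinear_scaleR]
        Ck_on_bilinear[OF _ bounded_bilinear_inner] Ck_on_const) auto
  show "(\<Sum>b\<in>Basis. (X x \<bullet> b) *\<^sub>R frechet_derivative f (at x) b)
      = frechet_derivative f (at x) (X x)" if "x \<in> U" for x
  proof -
    have "linear (frechet_derivative f (at x))"
      using assms(2) that by (simp add: linear_frechet_derivative)
    then have "frechet_derivative f (at x) (\<Sum>b\<in>Basis. (X x \<bullet> b) *\<^sub>R b)
        = (\<Sum>b\<in>Basis. (X x \<bullet> b) *\<^sub>R frechet_derivative f (at x) b)"
      by (simp add: linear_sum linear_cmul)
    then show ?thesis
      by (simp add: euclidean_representation)
  qed
qed

section \<open>Smooth functions and differentials on a subset of the ambient space\<close>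

lemma smooth_fun_cong:
  assumes "smooth_fun M f" "\<And>x. x \<in> M \<Longrightarrow> g x = f x"
  shows "smooth_fun M g"
  unfolding smooth_fun_def
proof
  fix p assume "p \<in> M"
  then obtain U h where "open U" "p \<in> U" "\<forall>k. Ck_on k U h" "\<forall>x\<in>U \<inter> M. h x = f x"
    using assms(1) unfolding smooth_fun_def by blast
  then show "\<exists>U h. open U \<and> p \<in> U \<and> (\<forall>k. Ck_on k U h) \<and> (\<forall>x\<in>U \<inter> M. h x = g x)"
    using assms(2) by (intro exI[of _ U] exI[of _ h]) auto
qed

lemma smooth_fun_linear: "bounded_linear L \<Longrightarrow> smooth_fun M L"
  unfolding smooth_fun_def by (blast intro: Ck_on_linear[OF open_UNIV])

lemma smooth_fun_const: "smooth_fun M (\<lambda>x. c)"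
  unfolding smooth_fun_def by (blast intro: Ck_on_const[OF open_UNIV])

lemma smooth_fun_bilinear:
  assumes B: "bounded_bilinear B" and f: "smooth_fun M f" and g: "smooth_fun M g"
  shows "smooth_fun M (\<lambda>x. B (f x) (g x))"
  unfolding smooth_fun_def
proof
  fix p assume p: "p \<in> M"
  obtain U f' where U: "open U" "p \<in> U" "\<And>k. Ck_on k U f'" "\<forall>x\<in>U \<inter> M. f' x = f x"
    using f p unfolding smooth_fun_def by blast
  obtain V g' where V: "open V" "p \<in> V" "\<And>k. Ck_on k V g'" "\<forall>x\<in>V \<inter> M. g' x = g x"
    using g p unfolding smooth_fun_def by blast
  have "Ck_on k (U \<inter> V) (\<lambda>x. B (f' x) (g' x))" for k
    by (intro Ck_on_bilinear[OF _ B] open_Int U(1) V(1) Ck_on_subset[OF U(3)] Ck_on_subset[OF V(3)])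
      auto
  then show "\<exists>W h. open W \<and> p \<in> W \<and> (\<forall>k. Ck_on k W h) \<and> (\<forall>x\<in>W \<inter> M. h x = B (f x) (g x))"
    using U V by (intro exI[of _ "U \<inter> V"] exI[of _ "\<lambda>x. B (f' x) (g' x)"]) auto
qed

lemma smooth_fun_add:
  assumes f: "smooth_fun M f" and g: "smooth_fun M g"
  shows "smooth_fun M (\<lambda>x. f x + g x)"
  unfolding smooth_fun_def
proof
  fix p assume p: "p \<in> M"
  obtain U f' where U: "open U" "p \<in> U" "\<And>k. Ck_on k U f'" "\<forall>x\<in>U \<inter> M. f' x = f x"
    using f p unfolding smooth_fun_def by blast
  obtain V g' where V: "open V" "p \<in> V" "\<And>k. Ck_on k V g'" "\<forall>x\<in>V \<inter> M. g' x = g x"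
    using g p unfolding smooth_fun_def by blast
  have "Ck_on k (U \<inter> V) (\<lambda>x. f' x + g' x)" for k
    by (intro Ck_on_add open_Int U(1) V(1) Ck_on_subset[OF U(3)] Ck_on_subset[OF V(3)]) auto
  then show "\<exists>W h. open W \<and> p \<in> W \<and> (\<forall>k. Ck_on k W h) \<and> (\<forall>x\<in>W \<inter> M. h x = f x + g x)"
    using U V by (intro exI[of _ "U \<inter> V"] exI[of _ "\<lambda>x. f' x + g' x"]) auto
qed

lemma smooth_fun_linear_comp:
  assumes L: "bounded_linear L" and f: "smooth_fun M f"
  shows "smooth_fun M (\<lambda>x. L (f x))"
proof -
  have "bounded_bilinear (\<lambda>(c::real) y. c *\<^sub>R L y)"
    using bounded_bilinear.comp[OF bounded_bilinear_scaleR bounded_linear_ident L] .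
  from smooth_fun_bilinear[OF this smooth_fun_const[of M 1] f] show ?thesis
    by simp
qed

lemma dM_has_derivative:
  assumes "smooth_fun M f" "p \<in> M"
  shows "(f has_derivative dM M f p) (at p within M)"
proof -
  obtain U g where U: "open U" "p \<in> U" "\<And>k. Ck_on k U g" "\<forall>x\<in>U \<inter> M. g x = f x"
    using assms unfolding smooth_fun_def by blast
  have "(g has_derivative frechet_derivative g (at p)) (at p within M)"
    using Ck_on_has_derivative[OF U(3) U(2)] by (rule has_derivative_at_withinI)
  moreover obtain d where "d > 0" "ball p d \<subseteq> U"
    using U openE by blast
  ultimately have "(f has_derivative frechet_derivative g (at p)) (at p within M)"
    using U(4) assms(2) by (elim has_derivative_transform_within[of _ _ _ _ d])
      (auto simp: dist_commute subset_eq)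
  then have "f differentiable (at p within M)"
    by (auto simp: differentiable_def)
  then show ?thesis
    unfolding dM_def[abs_def] by (simp flip: frechet_derivative_works)
qed

text \<open>Differentials are chosen arbitrarily in directions transverse to \<open>M\<close>; along a curve in \<open>M\<close>
  the chain rule leaves no choice.\<close>

lemma dM_eq:
  assumes f: "(f has_derivative f') (at p within M)" and v: "v \<in> tangent_space M p"
  shows "dM M f p v = f' v"
proof -
  obtain \<gamma> where g: "\<gamma> 0 = p" "\<And>t::real. \<gamma> t \<in> M" "(\<gamma> has_vector_derivative v) (at 0)"
    using v unfolding tangent_space_def by blast
  have chain: "(f \<circ> \<gamma> has_vector_derivative h v) (at 0)"
    if "(f has_derivative h) (at p within M)" for h
  proof -
    have "(f has_derivative h) (at (\<gamma> 0) within range \<gamma>)"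
      using that g(1,2) by (auto intro: has_derivative_subset)
    from vector_derivative_diff_chain_within[OF g(3) this] show ?thesis .
  qed
  have "f differentiable (at p within M)"
    using f by (auto simp: differentiable_def)
  then have "(f has_derivative dM M f p) (at p within M)"
    unfolding dM_def[abs_def] by (simp flip: frechet_derivative_works)
  from vector_derivative_unique_at[OF chain[OF this] chain[OF f]] show ?thesis .
qed

lemma dM_cong:
  assumes "p \<in> M" "\<And>x. x \<in> M \<Longrightarrow> f x = g x"
  shows "dM M f p v = dM M g p v"
proof -
  have "(f has_derivative h) (at p within M) \<longleftrightarrow> (g has_derivative h) (at p within M)" for h
    using has_derivative_transform[OF assms(1), of f g h]
      has_derivative_transform[OF assms(1), of g f h] assms(2) by auto
  then show ?thesis
    by (simp add: dM_def frechet_derivative_def)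
qed

lemma smooth_fun_dM:
  assumes f: "smooth_fun M f" and X: "vector_field M X"
  shows "smooth_fun M (\<lambda>p. dM M f p (X p))"
  unfolding smooth_fun_def
proof
  fix p assume p: "p \<in> M"
  obtain U g where U: "open U" "p \<in> U" "\<And>k. Ck_on k U g" "\<forall>x\<in>U \<inter> M. g x = f x"
    using f p unfolding smooth_fun_def by blast
  obtain V Y where V: "open V" "p \<in> V" "\<And>k. Ck_on k V Y" "\<forall>x\<in>V \<inter> M. Y x = X x"
    using X p unfolding vector_field_def smooth_fun_def by blast
  let ?h = "\<lambda>x. frechet_derivative g (at x) (Y x)"
  have 1: "Ck_on k (U \<inter> V) ?h" for k
    using U V by (intro Ck_on_directional_derivative Ck_on_subset[OF U(3)] Ck_on_subset[OF V(3)]) auto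
  have 2: "?h x = dM M f x (X x)" if x: "x \<in> (U \<inter> V) \<inter> M" for x
  proof -
    have "(g has_derivative frechet_derivative g (at x)) (at x within M)"
      using Ck_on_has_derivative[OF U(3)] x by (blast intro: has_derivative_at_withinI)
    moreover obtain d where "d > 0" "ball x d \<subseteq> U"
      using U x openE by blast
    ultimately have "(f has_derivative frechet_derivative g (at x)) (at x within M)"
      using U(4) x by (elim has_derivative_transform_within[of _ _ _ _ d])
        (auto simp: dist_commute subset_eq)
    then show ?thesis
      using dM_eq X V(4) x unfolding vector_field_def by fastforce
  qed
  show "\<exists>W h. open W \<and> p \<in> W \<and> (\<forall>k. Ck_on k W h) \<and> (\<forall>x\<in>W \<inter> M. h x = dM M f x (X x))"
    using U V 1 2 by (intro exI[of _ "U \<inter> V"] exI[of _ ?h]) auto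
qed

lemma smooth_fun_scaleR:
  "smooth_fun M f \<Longrightarrow> smooth_fun M g \<Longrightarrow> smooth_fun M (\<lambda>x. f x *\<^sub>R g x)"
  by (rule smooth_fun_bilinear[OF bounded_bilinear_scaleR])

lemma smooth_fun_mult:
  "smooth_fun M f \<Longrightarrow> smooth_fun M g \<Longrightarrow> smooth_fun M (\<lambda>x. f x * g x :: real)"
  by (rule smooth_fun_bilinear[OF bounded_bilinear_mult])

lemma smooth_fun_id: "smooth_fun M (\<lambda>x. x)"
  by (rule smooth_fun_linear[OF bounded_linear_ident])

lemma smooth_fun_minus: "smooth_fun M f \<Longrightarrow> smooth_fun M (\<lambda>x. - f x)"
  by (rule smooth_fun_linear_comp[OF bounded_linear_minus[OF bounded_linear_ident]])

lemma smooth_fun_diff: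
  "smooth_fun M f \<Longrightarrow> smooth_fun M g \<Longrightarrow> smooth_fun M (\<lambda>x. f x - g x)"
  using smooth_fun_add[OF _ smooth_fun_minus, of M f g] by simp

lemma dM_bilinear:
  assumes "bounded_bilinear B" "smooth_fun M f" "smooth_fun M g" "p \<in> M" "v \<in> tangent_space M p"
  shows "dM M (\<lambda>q. B (f q) (g q)) p v = B (f p) (dM M g p v) + B (dM M f p v) (g p)"
  using assms by (intro dM_eq[OF bounded_bilinear.FDERIV] dM_has_derivative)

lemma dM_add:
  assumes "smooth_fun M f" "smooth_fun M g" "p \<in> M" "v \<in> tangent_space M p"
  shows "dM M (\<lambda>q. f q + g q) p v = dM M f p v + dM M g p v"
  using assms by (intro dM_eq[OF has_derivative_add] dM_has_derivative)

lemma dM_bounded_linear: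
  assumes "bounded_linear L" "smooth_fun M f" "p \<in> M" "v \<in> tangent_space M p"
  shows "dM M (\<lambda>q. L (f q)) p v = L (dM M f p v)"
  using assms by (intro dM_eq[OF bounded_linear.has_derivative] dM_has_derivative)

lemma dM_const: "v \<in> tangent_space M p \<Longrightarrow> dM M (\<lambda>q. c) p v = 0"
  by (rule dM_eq[OF has_derivative_const])

lemma dM_id: "v \<in> tangent_space M p \<Longrightarrow> dM M (\<lambda>q. q) p v = v"
  by (rule dM_eq[OF has_derivative_ident])

lemmas dM_scaleR = dM_bilinear[OF bounded_bilinear_scaleR]

lemma vector_fieldD:
  assumes "vector_field M X"
  shows "smooth_fun M X" "p \<in> M \<Longrightarrow> X p \<in> tangent_space M p"
  using assms by (simp_all add: vector_field_def)

lemma vector_field_cong: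
  assumes "vector_field M X" "\<And>p. p \<in> M \<Longrightarrow> Y p = X p"
  shows "vector_field M Y"
  using assms smooth_fun_cong[of M X Y] by (simp add: vector_field_def)

section \<open>The pseudo-Euclidean inner product\<close>

lemma pinner_commute: "pinner u x y = pinner u y x"
  by (simp add: pinner_def mult.commute mult.left_commute)

interpretation pinner: bounded_bilinear "pinner u" for u
proof -
  have "bilinear (pinner u)"
    unfolding bilinear_def by (auto intro!: linearI simp: pinner_def algebra_simps)
  then show "bounded_bilinear (pinner u)"
    by (simp add: bilinear_conv_bounded_bilinear)
qed

lemma smooth_fun_pinner:
  "smooth_fun M f \<Longrightarrow> smooth_fun M g \<Longrightarrow> smooth_fun M (\<lambda>x. pinner u (f x) (g x))"
  by (rule smooth_fun_bilinear[OF pinner.bounded_bilinear_axioms])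

lemmas smooth_fun_intros = smooth_fun_add smooth_fun_diff smooth_fun_minus smooth_fun_scaleR
  smooth_fun_mult smooth_fun_pinner smooth_fun_id smooth_fun_const

lemmas dM_pinner = dM_bilinear[OF pinner.bounded_bilinear_axioms]

lemma pinner_nondegenerate:
  assumes "\<And>z. pinner u w z = 0"
  shows "w = 0"
proof -
  have "w $ i = 0" for i
    using assms[of "axis i 1"] exhaust_3[of i]
    by (auto simp: pinner_def axis_def split: if_splits)
  then show ?thesis
    by (simp add: vec_eq_iff)
qed

lemma pinner_eq_sum:
  "pinner u x y = (\<Sum>r\<in>UNIV. pinner u (axis r 1) (axis r 1) * x $ r * y $ r)"
  by (simp add: sum_3 pinner_def axis_def)

lemma orthonormal_frame_sign_square:
  "orthonormal_frame u e \<Longrightarrow> pinner u (e i) (e i) * pinner u (e i) (e i) = 1"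
  unfolding orthonormal_frame_def by (metis insertE mult_1 mult_minus_left mult_minus_right
      minus_minus singletonD)

text \<open>Orthonormality says that the matrix of a frame has a left inverse built from the metric; it is
  a right inverse as well, and this is the expansion.\<close>

lemma orthonormal_frame_expansion:
  assumes "orthonormal_frame u e"
  shows "w = (\<Sum>i\<in>UNIV. (pinner u (e i) (e i) * pinner u w (e i)) *\<^sub>R e i)"
proof -
  define g where "g r = pinner u (axis r 1) (axis r 1)" for r :: 3
  define E :: "real^3^3" where "E = (\<chi> r i. e i $ r)"
  define F :: "real^3^3" where "F = (\<chi> i r. pinner u (e i) (e i) * (g r * e i $ r))"
  have g: "pinner u x y = (\<Sum>r\<in>UNIV. g r * x $ r * y $ r)" for x y
    unfolding g_def by (rule pinner_eq_sum)
  have "(F ** E) $ i $ j = pinner u (e i) (e i) * pinner u (e i) (e j)" for i j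
    by (simp add: F_def E_def matrix_matrix_mult_def g[of "e i" "e j"] sum_distrib_left mult.assoc)
  then have "F ** E = mat 1"
    using assms orthonormal_frame_sign_square[OF assms]
    by (simp add: vec_eq_iff mat_def orthonormal_frame_def)
  then have "E ** F = mat 1"
    by (simp add: matrix_left_right_inverse)
  then have "E *v (F *v w) = w"
    by (simp add: matrix_vector_mul_assoc)
  moreover have "(F *v w) $ i = pinner u (e i) (e i) * pinner u w (e i)" for i
    by (simp add: F_def matrix_vector_mult_def g[of w "e i"] sum_distrib_left mult_ac)
  then have "(E *v (F *v w)) $ r
      = (\<Sum>i\<in>UNIV. (pinner u (e i) (e i) * pinner u w (e i)) *\<^sub>R e i) $ r" for r
    by (subst matrix_vector_mult_def) (simp add: E_def mult.commute)
  then have "E *v (F *v w) = (\<Sum>i\<in>UNIV. (pinner u (e i) (e i) * pinner u w (e i)) *\<^sub>R e i)"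
    unfolding vec_eq_iff by blast
  ultimately show ?thesis
    by simp
qed

text \<open>The witness is the cross product of \<open>p\<close> and \<open>x\<close> with its index raised by the metric. By Lagrange's
  identity \<open>\<langle>y, y\<rangle> = det (\<langle>p, p\<rangle> \<langle>x, x\<rangle> - \<langle>p, x\<rangle>\<^sup>2)\<close>, where \<open>det = \<plusminus>1\<close> is the determinant of the
  metric, so it is not null and already has length one.\<close>

lemma ex_orthonormal_completion:
  assumes "pinner u p p = s" "s = 1 \<or> s = -1" "pinner u x x = d" "d = 1 \<or> d = -1" "pinner u p x = 0"
  shows "\<exists>y. pinner u y p = 0 \<and> pinner u y x = 0 \<and> (pinner u y y = 1 \<or> pinner u y y = -1)"
proof -
  define g where "g r = pinner u (axis r 1) (axis r 1)" for r :: 3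
  have g: "pinner u x y = (\<Sum>r\<in>UNIV. g r * x $ r * y $ r)" for x y
    unfolding g_def by (rule pinner_eq_sum)
  have g1: "g r * g r = 1" for r
    using exhaust_3[of r] by (auto simp: g_def pinner_def axis_def)
  have g1': "g r * (g r * a) = a" for r a
    using g1[of r] by (simp flip: mult.assoc)
  have g_cases: "g r = 1 \<or> g r = -1" for r
    using g1[of r] by (simp add: square_eq_1_iff)
  define y :: vec3 where "y = vector [g 1 * (p$2 * x$3 - p$3 * x$2),
      g 2 * (p$3 * x$1 - p$1 * x$3), g 3 * (p$1 * x$2 - p$2 * x$1)]"
  have y: "y$1 = g 1 * (p$2 * x$3 - p$3 * x$2)" "y$2 = g 2 * (p$3 * x$1 - p$1 * x$3)"
    "y$3 = g 3 * (p$1 * x$2 - p$2 * x$1)"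
    by (simp_all add: y_def)
  have lin: "pinner u y z = (p$2 * x$3 - p$3 * x$2) * z$1 + (p$3 * x$1 - p$1 * x$3) * z$2
      + (p$1 * x$2 - p$2 * x$1) * z$3" for z
    by (simp add: g sum_3 y g1' mult.assoc)
  have "pinner u y y = g 1 * g 2 * g 3 * (pinner u p p * pinner u x x - pinner u p x * pinner u p x)"
    unfolding lin[of y] y unfolding g sum_3
    using g_cases[of 1] g_cases[of 2] g_cases[of 3] by (elim disjE) (simp_all add: algebra_simps)
  then have yy: "pinner u y y = g 1 * g 2 * g 3 * s * d"
    using assms by simp
  have "pinner u y y = 1 \<or> pinner u y y = -1"
    unfolding yy using assms(2,4) g_cases[of 1] g_cases[of 2] g_cases[of 3] by (elim disjE) simp_all
  moreover have "pinner u y p = 0" "pinner u y x = 0"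
    unfolding lin by (simp_all add: algebra_simps)
  ultimately show ?thesis
    by blast
qed

section \<open>Nondegenerate quadrics\<close>

locale nondegenerate_quadric =
  fixes u :: nat and s :: real and M :: "vec3 set"
  assumes M_eq: "M = {x. pinner u x x = s}" and s_cases: "s = 1 \<or> s = -1" and nonempty: "M \<noteq> {}"

lemma quadric_nondegenerate:
  assumes "quadric u M"
  shows "\<exists>s. nondegenerate_quadric u s M"
proof -
  obtain v where v: "v \<le> 2"
    and "(u = v \<and> M = pseudo_sphere v) \<or> (u = v + 1 \<and> M = pseudo_hyperbolic v)"
    using assms unfolding quadric_def by blast
  from this(2) show ?thesis
  proof
    assume M: "u = v \<and> M = pseudo_sphere v"
    moreover have "axis 1 1 \<in> pseudo_sphere v"
      using v by (simp add: pseudo_sphere_def pinner_def axis_def)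
    ultimately have "nondegenerate_quadric u 1 M"
      by unfold_locales (auto simp: pseudo_sphere_def)
    then show ?thesis ..
  next
    assume M: "u = v + 1 \<and> M = pseudo_hyperbolic v"
    moreover have "axis 3 1 \<in> pseudo_hyperbolic v"
      by (simp add: pseudo_hyperbolic_def pinner_def axis_def)
    ultimately have "nondegenerate_quadric u (-1) M"
      by unfold_locales (auto simp: pseudo_hyperbolic_def)
    then show ?thesis ..
  qed
qed

context nondegenerate_quadric
begin

lemma ss: "s * s = 1"
  using s_cases by auto

lemma ss_cancel: "s * (s * x) = x"
  using s_cases by auto

lemma pinner_self: "p \<in> M \<Longrightarrow> pinner u p p = s"
  by (simp add: M_eq)

text \<open>Differentiating \<open>\<langle>p, p\<rangle> = s\<close> along a curve gives one inclusion. For the other, a tangent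
  candidate \<open>v\<close> is the velocity of the rational parametrisation of the conic which the plane
  spanned by \<open>p\<close> and \<open>v\<close> cuts out of \<open>M\<close>.\<close>

lemma tangent_space_eq:
  assumes p: "p \<in> M"
  shows "tangent_space M p = {v. pinner u p v = 0}"
proof safe
  fix v assume "v \<in> tangent_space M p"
  then obtain \<gamma> where g: "\<gamma> 0 = p" "\<And>t::real. \<gamma> t \<in> M" "(\<gamma> has_vector_derivative v) (at 0)"
    unfolding tangent_space_def by blast
  have "((\<lambda>t. pinner u (\<gamma> t) (\<gamma> t)) has_vector_derivative (pinner u (\<gamma> 0) v + pinner u v (\<gamma> 0))) (at 0)"
    by (rule pinner.has_vector_derivative[OF g(3) g(3)])
  moreover have "((\<lambda>t. pinner u (\<gamma> t) (\<gamma> t)) has_vector_derivative 0) (at 0)"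
    using g(2) by (simp add: pinner_self)
  ultimately have "pinner u (\<gamma> 0) v + pinner u v (\<gamma> 0) = 0"
    by (rule vector_derivative_unique_at)
  then show "pinner u p v = 0"
    using g(1) by (simp add: pinner_commute)
next
  fix v assume v: "pinner u p v = 0"
  \<comment> \<open>The value of \<open>k\<close> makes \<open>(1 - k t\<^sup>2)\<^sup>2 s + t\<^sup>2 \<langle>v, v\<rangle>\<close> equal to \<open>s (1 + k t\<^sup>2)\<^sup>2\<close>.\<close>
  define k where "k = s * pinner u v v / 4"
  define c where "c t = (1 / (1 + k * t\<^sup>2)) *\<^sub>R ((1 - k * t\<^sup>2) *\<^sub>R p + t *\<^sub>R v)" for t :: real
  \<comment> \<open>For \<open>k < 0\<close> the curve \<open>c\<close> has poles; they are away from \<open>0\<close>, where alone the curve matters.\<close>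
  define \<gamma> where "\<gamma> t = (if 1 + k * t\<^sup>2 = 0 then p else c t)" for t
  have "\<gamma> t \<in> M" for t
  proof (cases "1 + k * t\<^sup>2 = 0")
    case False
    have "pinner u (c t) (c t)
        = ((1 - k * t\<^sup>2)\<^sup>2 * s + t\<^sup>2 * pinner u v v) / (1 + k * t\<^sup>2)\<^sup>2"
      using v pinner_self[OF p]
      by (simp add: c_def pinner.add_left pinner.add_right pinner.scaleR_left pinner.scaleR_right
          pinner_commute[of u v p] power2_eq_square divide_simps)
    also have "pinner u v v = 4 * s * k"
      by (simp add: k_def ss_cancel)
    also have "(1 - k * t\<^sup>2)\<^sup>2 * s + t\<^sup>2 * (4 * s * k) = s * (1 + k * t\<^sup>2)\<^sup>2"
      by algebra
    finally show ?thesis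
      using False by (simp add: M_eq \<gamma>_def)
  qed (use p in \<open>simp add: \<gamma>_def\<close>)
  moreover have "(\<gamma> has_vector_derivative v) (at 0)"
  proof -
    have "(c has_vector_derivative v) (at 0)"
      unfolding c_def by (auto intro!: derivative_eq_intros simp: has_vector_derivative_def)
    moreover have "open {t. 1 + k * t\<^sup>2 \<noteq> 0}"
      by (intro open_Collect_neq continuous_intros)
    ultimately show ?thesis
      by (rule has_vector_derivative_transform_within_open) (auto simp: \<gamma>_def)
  qed
  moreover have "\<gamma> 0 = p"
    by (simp add: \<gamma>_def c_def)
  ultimately show "v \<in> tangent_space M p"
    unfolding tangent_space_def by blast
qed

end

section \<open>The Levi-Civita connection of a quadric\<close>

lemma levi_civita_vector_field:
  assumes "levi_civita u M D" "vector_field M X" "vector_field M Y"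
  shows "vector_field M (D X Y)"
proof -
  have "affine_connection M D"
    using assms(1) unfolding levi_civita_def by (rule conjunct1)
  then have "\<forall>X Y. vector_field M X \<longrightarrow> vector_field M Y \<longrightarrow> vector_field M (D X Y)"
    unfolding affine_connection_def by (rule conjunct1)
  then show ?thesis
    using assms(2,3) by blast
qed

text \<open>Metric compatibility and torsion-freeness give six linear equations for the six products of
  covariant derivatives of three fields; this is their solution.\<close>

lemma koszul_formula:
  assumes "levi_civita u M D" and X: "vector_field M X" and Y: "vector_field M Y"
    and Z: "vector_field M Z" and p: "p \<in> M"
  shows "2 * pinner u (D X Y p) (Z p) =
    dM M (\<lambda>q. pinner u (Y q) (Z q)) p (X p) + dM M (\<lambda>q. pinner u (Z q) (X q)) p (Y p)
    - dM M (\<lambda>q. pinner u (X q) (Y q)) p (Z p)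
    + pinner u (lie_bracket M X Y p) (Z p) - pinner u (lie_bracket M X Z p) (Y p)
    - pinner u (lie_bracket M Y Z p) (X p)"
proof -
  have m: "dM M (\<lambda>q. pinner u (Y q) (Z q)) p (X p) = pinner u (D X Y p) (Z p) + pinner u (Y p) (D X Z p)"
    if "vector_field M X" "vector_field M Y" "vector_field M Z" for X Y Z
    using assms(1) that p unfolding levi_civita_def metric_connection_def by blast
  have t: "lie_bracket M X Y p = D X Y p - D Y X p"
    if "vector_field M X" "vector_field M Y" for X Y
    using assms(1) that p unfolding levi_civita_def torsion_free_def by metis
  show ?thesis
    unfolding m[OF X Y Z] m[OF Y Z X] m[OF Z X Y] t[OF X Y] t[OF X Z] t[OF Y Z] pinner.diff_left
    by (simp add: pinner_commute[of u "X p"] pinner_commute[of u "Y p"] pinner_commute[of u "Z p"])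
qed

context nondegenerate_quadric
begin

definition tangent_projection :: "vec3 \<Rightarrow> vec3 \<Rightarrow> vec3" where
  "tangent_projection p w = w - (s * pinner u w p) *\<^sub>R p"

lemma pinner_tangent_projection: "p \<in> M \<Longrightarrow> pinner u p (tangent_projection p w) = 0"
  using s_cases by (auto simp: tangent_projection_def pinner.diff_right pinner.scaleR_right
      pinner_self pinner_commute[of u w p])

lemma tangent_projection_id: "pinner u p w = 0 \<Longrightarrow> tangent_projection p w = w"
  by (simp add: tangent_projection_def pinner_commute[of u w p])

lemma pinner_vector_field: "vector_field M X \<Longrightarrow> p \<in> M \<Longrightarrow> pinner u p (X p) = 0"
  using vector_fieldD(2) tangent_space_eq by blast

lemma vector_fieldI:
  "smooth_fun M X \<Longrightarrow> (\<And>p. p \<in> M \<Longrightarrow> pinner u p (X p) = 0) \<Longrightarrow> vector_field M X"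
  by (simp add: vector_field_def tangent_space_eq)

lemma vector_field_projection:
  "smooth_fun M f \<Longrightarrow> vector_field M (\<lambda>q. tangent_projection q (f q))"
  by (rule vector_fieldI)
    (auto simp: pinner_tangent_projection,
      auto simp: tangent_projection_def intro!: smooth_fun_intros)

lemma ex_vector_field:
  assumes "p \<in> M" "pinner u p v = 0"
  obtains X where "vector_field M X" "X p = v"
  using vector_field_projection[OF smooth_fun_const] tangent_projection_id[OF assms(2)] that
  by blast

lemma tangent_nondegenerate:
  assumes p: "p \<in> M" and w: "pinner u p w = 0"
    and orth: "\<And>v. pinner u p v = 0 \<Longrightarrow> pinner u w v = 0"
  shows "w = 0"
proof (rule pinner_nondegenerate)
  fix z
  have "pinner u w (tangent_projection p z) = 0"
    by (rule orth[OF pinner_tangent_projection[OF p]])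
  then show "pinner u w z = 0"
    using w by (simp add: tangent_projection_def pinner.diff_right pinner.scaleR_right
        pinner_commute[of u w p])
qed

lemma levi_civita_unique:
  assumes "levi_civita u M D" "levi_civita u M D'" and X: "vector_field M X" and Y: "vector_field M Y"
    and p: "p \<in> M"
  shows "D X Y p = D' X Y p"
proof -
  have vf: "vector_field M (D X Y)" "vector_field M (D' X Y)"
    by (rule levi_civita_vector_field[OF assms(1) X Y], rule levi_civita_vector_field[OF assms(2) X Y])
  have "D X Y p - D' X Y p = 0"
  proof (rule tangent_nondegenerate[OF p])
    show "pinner u p (D X Y p - D' X Y p) = 0"
      using pinner_vector_field[OF vf(1) p] pinner_vector_field[OF vf(2) p]
      by (simp add: pinner.diff_right)
    fix v assume v: "pinner u p v = 0"
    obtain Z where Z: "vector_field M Z" "Z p = v"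
      using p v by (rule ex_vector_field)
    show "pinner u (D X Y p - D' X Y p) v = 0"
      using koszul_formula[OF assms(1) X Y Z(1) p] koszul_formula[OF assms(2) X Y Z(1) p] Z(2)
      by (simp add: pinner.diff_left)
  qed
  then show ?thesis by simp
qed

text \<open>This is the tangential part of the ambient derivative: differentiating \<open>\<langle>q, Y q\<rangle> = 0\<close> shows that the
  normal part of \<open>dM M Y p (X p)\<close> is \<open>- s \<langle>X p, Y p\<rangle> p\<close>.\<close>

definition tangential_derivative :: "(vec3 \<Rightarrow> vec3) \<Rightarrow> (vec3 \<Rightarrow> vec3) \<Rightarrow> vec3 \<Rightarrow> vec3" where
  "tangential_derivative X Y p = dM M Y p (X p) + (s * pinner u (X p) (Y p)) *\<^sub>R p"

lemma pinner_dM_vector_field: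
  assumes Y: "vector_field M Y" and p: "p \<in> M" and v: "v \<in> tangent_space M p"
  shows "pinner u p (dM M Y p v) = - pinner u v (Y p)"
proof -
  have "dM M (\<lambda>q. pinner u q (Y q)) p v = dM M (\<lambda>q. 0) p v"
    using p by (rule dM_cong) (rule pinner_vector_field[OF Y])
  then show ?thesis
    using dM_pinner[OF smooth_fun_id vector_fieldD(1)[OF Y] p v] v
    by (simp add: dM_const dM_id)
qed

lemma vector_field_tangential_derivative:
  assumes X: "vector_field M X" and Y: "vector_field M Y"
  shows "vector_field M (tangential_derivative X Y)"
proof (rule vector_fieldI)
  show "smooth_fun M (tangential_derivative X Y)"
    unfolding tangential_derivative_def[abs_def]
    by (intro smooth_fun_intros smooth_fun_dM vector_fieldD X Y)
  show "pinner u p (tangential_derivative X Y p) = 0" if "p \<in> M" for p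
    using pinner_dM_vector_field[OF Y that vector_fieldD(2)[OF X that]] pinner_self[OF that] ss
    by (simp add: tangential_derivative_def pinner.add_right pinner.scaleR_right)
qed

lemma linear_dM: "smooth_fun M f \<Longrightarrow> p \<in> M \<Longrightarrow> linear (dM M f p)"
  using dM_has_derivative has_derivative_linear by blast

lemma levi_civita_tangential_derivative: "levi_civita u M tangential_derivative"
proof -
  have "affine_connection M tangential_derivative"
    unfolding affine_connection_def
    by (auto simp: vector_field_tangential_derivative)
      (auto simp: tangential_derivative_def vector_fieldD dM_add dM_scaleR
        linear_add[OF linear_dM] linear_cmul[OF linear_dM] pinner.add_left pinner.add_right
        pinner.scaleR_left pinner.scaleR_right algebra_simps)
  moreover have "torsion_free M tangential_derivative"
    unfolding torsion_free_def
    by (auto simp: tangential_derivative_def lie_bracket_def pinner_commute)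
  moreover have "metric_connection u M tangential_derivative"
    unfolding metric_connection_def
  proof (intro allI impI ballI)
    fix X Y Z p assume X: "vector_field M X" and Y: "vector_field M Y" and Z: "vector_field M Z"
      and p: "p \<in> M"
    show "dM M (\<lambda>q. pinner u (Y q) (Z q)) p (X p)
      = pinner u (tangential_derivative X Y p) (Z p) + pinner u (Y p) (tangential_derivative X Z p)"
      using dM_pinner[OF vector_fieldD(1)[OF Y] vector_fieldD(1)[OF Z] p vector_fieldD(2)[OF X p]]
        pinner_vector_field[OF Y p] pinner_vector_field[OF Z p]
      by (simp add: tangential_derivative_def pinner.add_left pinner.add_right pinner.scaleR_left
          pinner.scaleR_right pinner_commute[of u "Y p" p])
  qed
  ultimately show ?thesis
    by (simp add: levi_civita_def)
qed

lemma levi_civita_nabla: "levi_civita u M (nabla u M)"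
  unfolding nabla_def using levi_civita_tangential_derivative by (rule someI[of "levi_civita u M"])

lemma vector_field_nabla: "vector_field M X \<Longrightarrow> vector_field M Y \<Longrightarrow> vector_field M (nabla u M X Y)"
  using levi_civita_nabla by (rule levi_civita_vector_field)

lemma nabla_eq:
  assumes "vector_field M X" "vector_field M Y" "p \<in> M"
  shows "nabla u M X Y p = dM M Y p (X p) + (s * pinner u (X p) (Y p)) *\<^sub>R p"
  using levi_civita_unique[OF levi_civita_nabla levi_civita_tangential_derivative assms]
  by (simp add: tangential_derivative_def)

end

section \<open>Fields with a skew-symmetric linear extension\<close>

locale linear_killing_field = nondegenerate_quadric +
  fixes \<sigma> A :: "vec3 \<Rightarrow> vec3"
  assumes extension: "linear_extension u M \<sigma> A"
begin

lemma bounded_linear_A: "bounded_linear A"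
  using extension by (simp add: linear_extension_def linear_linear)

lemma linear_A: "linear A"
  using bounded_linear_A by (rule bounded_linear.linear)

lemma skew: "pinner u (A x) y = - pinner u x (A y)"
  using extension by (simp add: linear_extension_def)

lemma skew_self: "pinner u x (A x) = 0"
  using skew[of x x] by (simp add: pinner_commute[of u "A x"])

lemma \<sigma>_eq: "x \<in> M \<Longrightarrow> \<sigma> x = A x"
  using extension by (simp add: linear_extension_def)

lemma smooth_A: "smooth_fun M A"
  by (rule smooth_fun_linear[OF bounded_linear_A])

lemma vector_field_\<sigma>: "vector_field M \<sigma>"
  by (rule vector_fieldI[OF smooth_fun_cong[OF smooth_A \<sigma>_eq]]) (simp_all add: \<sigma>_eq skew_self)

text \<open>A linear map that vanishes on \<open>M\<close> kills \<open>p \<in> M\<close> and, by differentiation, the tangent space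
  at \<open>p\<close>.\<close>

lemma linear_extension_unique:
  assumes B: "linear_extension u M \<sigma> B"
  shows "B = A"
proof
  fix x
  obtain p where p: "p \<in> M"
    using nonempty by blast
  have lB: "linear B"
    using B by (simp add: linear_extension_def)
  have eq: "B q = A q" if "q \<in> M" for q
    using B that \<sigma>_eq by (simp add: linear_extension_def)
  define v where "v = tangent_projection p x"
  have v: "v \<in> tangent_space M p"
    using p by (simp add: v_def tangent_space_eq pinner_tangent_projection)
  have "dM M B p v = dM M A p v"
    using p by (rule dM_cong) (rule eq)
  then have Bv: "B v = A v"
    using v lB bounded_linear_A
    by (simp add: dM_eq[OF bounded_linear_imp_has_derivative] linear_linear)
  have "B (v + (s * pinner u x p) *\<^sub>R p) = A (v + (s * pinner u x p) *\<^sub>R p)"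
    by (simp add: linear_add[OF lB] linear_add[OF linear_A] linear_cmul[OF lB]
        linear_cmul[OF linear_A] Bv eq[OF p])
  then show "B x = A x"
    by (simp add: v_def tangent_projection_def)
qed

lemma hat_field_eq: "hat_field u M \<sigma> x = A (A (A x))"
proof -
  have "(THE B. linear_extension u M \<sigma> B) = A"
    using extension linear_extension_unique by (rule the_equality)
  then show ?thesis
    by (simp add: hat_field_def eval_nat_numeral)
qed

lemma nabla_\<sigma>:
  assumes X: "vector_field M X" and p: "p \<in> M"
  shows "nabla u M X \<sigma> p = A (X p) + (s * pinner u (X p) (A p)) *\<^sub>R p"
proof -
  have "dM M \<sigma> p (X p) = dM M A p (X p)"
    using p by (rule dM_cong) (rule \<sigma>_eq)
  also have "\<dots> = A (X p)"
    by (rule dM_eq[OF bounded_linear_imp_has_derivative[OF bounded_linear_A] vector_fieldD(2)[OF X p]])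
  finally show ?thesis
    using nabla_eq[OF X vector_field_\<sigma> p] p by (simp add: \<sigma>_eq)
qed

text \<open>\<open>\<nabla>\<^sup>2\<sigma>(X, X)\<close> is tensorial: both terms contain the derivative of \<open>X\<close>, as \<open>A (dX)\<close> and
  \<open>s \<langle>dX, A p\<rangle> p\<close>, and these contributions cancel.\<close>

lemma nabla2_\<sigma>:
  assumes X: "vector_field M X" and p: "p \<in> M"
  shows "nabla2 u M X X \<sigma> p
    = (s * pinner u (X p) (A p)) *\<^sub>R X p - (s * pinner u (X p) (X p)) *\<^sub>R A p"
proof -
  let ?x = "X p" and ?dX = "dM M X p (X p)"
  note sX = vector_fieldD(1)[OF X] and v = vector_fieldD(2)[OF X p]
  have sAX: "smooth_fun M (\<lambda>q. A (X q))"
    by (rule smooth_fun_linear_comp[OF bounded_linear_A sX])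
  have dA: "dM M A p ?x = A ?x"
    by (rule dM_eq[OF bounded_linear_imp_has_derivative[OF bounded_linear_A] v])
  have "dM M (nabla u M X \<sigma>) p ?x
      = dM M (\<lambda>q. A (X q) + (s * pinner u (X q) (A q)) *\<^sub>R q) p ?x"
    using p by (rule dM_cong) (rule nabla_\<sigma>[OF X])
  also have "\<dots> = A ?dX + ((s * pinner u ?x (A p)) *\<^sub>R ?x + (s * pinner u ?dX (A p)) *\<^sub>R p)"
    using p v sX sAX smooth_A
    by (simp add: dM_add dM_scaleR dM_bilinear[OF bounded_bilinear_mult] dM_pinner dM_id dM_const
        dM_bounded_linear[OF bounded_linear_A] dA smooth_fun_intros skew_self)
  finally have 1: "nabla u M X (nabla u M X \<sigma>) p
      = A ?dX + (s * pinner u ?x (A p)) *\<^sub>R ?x + (s * pinner u ?dX (A p)) *\<^sub>R p"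
    using nabla_eq[OF X vector_field_nabla[OF X vector_field_\<sigma>] p] nabla_\<sigma>[OF X p]
      pinner_vector_field[OF X p]
    by (simp add: pinner.add_right pinner.scaleR_right skew_self pinner_commute[of u ?x p])
  have "nabla u M (nabla u M X X) \<sigma> p
      = A ?dX + (s * pinner u ?x ?x) *\<^sub>R A p + (s * pinner u ?dX (A p)) *\<^sub>R p"
    using nabla_\<sigma>[OF vector_field_nabla[OF X X] p]
    by (simp add: nabla_eq[OF X X p] linear_add[OF linear_A] linear_cmul[OF linear_A]
        pinner.add_left pinner.scaleR_left skew_self)
  then show ?thesis
    by (simp add: nabla2_def 1)
qed

text \<open>The first term of \<open>nabla2_\<sigma>\<close> has trace \<open>s \<sigma>\<close> and the second \<open>- 2 s \<sigma>\<close>, since \<open>M\<close> has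
  dimension two.\<close>

lemma trace_term:
  assumes XY: "orthonormal_at u M p X Y" and p: "p \<in> M"
  shows "pinner u (X p) (X p) *\<^sub>R nabla2 u M X X \<sigma> p + pinner u (Y p) (Y p) *\<^sub>R nabla2 u M Y Y \<sigma> p
    = - (s *\<^sub>R A p)"
proof -
  have X: "vector_field M X" and Y: "vector_field M Y"
    and on: "pinner u (X p) (X p) \<in> {1, -1}" "pinner u (Y p) (Y p) \<in> {1, -1}" "pinner u (X p) (Y p) = 0"
    using XY by (simp_all add: orthonormal_at_def)
  \<comment> \<open>Together with the unit normal \<open>p\<close> the two tangent vectors form an ambient frame, in which
    \<open>A p\<close> has no component along \<open>p\<close>.\<close>
  define e :: "3 \<Rightarrow> vec3" where "e i = (if i = 1 then p else if i = 2 then X p else Y p)" for i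
  have e: "e 1 = p" "e 2 = X p" "e 3 = Y p"
    by (simp_all add: e_def)
  have "orthonormal_frame u e"
    using on pinner_self[OF p] s_cases pinner_vector_field[OF X p] pinner_vector_field[OF Y p]
    by (simp add: orthonormal_frame_def forall_3 e pinner_commute[of u "X p" p]
        pinner_commute[of u "Y p" p] pinner_commute[of u "Y p" "X p"])
  from orthonormal_frame_expansion[OF this, of "A p"]
  have "A p = (pinner u (X p) (X p) * pinner u (X p) (A p)) *\<^sub>R X p
      + (pinner u (Y p) (Y p) * pinner u (Y p) (A p)) *\<^sub>R Y p"
    by (simp add: sum_3 e pinner_commute[of u "A p"] skew_self)
  then have "s *\<^sub>R A p = (s * pinner u (X p) (X p) * pinner u (X p) (A p)) *\<^sub>R X p
      + (s * pinner u (Y p) (Y p) * pinner u (Y p) (A p)) *\<^sub>R Y p"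
    by (metis (no_types, opaque_lifting) scaleR_add_right scaleR_scaleR mult.assoc)
  moreover have "pinner u (X p) (X p) * pinner u (X p) (X p) = 1"
    "pinner u (Y p) (Y p) * pinner u (Y p) (Y p) = 1"
    using on by auto
  then have "pinner u (X p) (X p) *\<^sub>R nabla2 u M X X \<sigma> p + pinner u (Y p) (Y p) *\<^sub>R nabla2 u M Y Y \<sigma> p
      = (s * pinner u (X p) (X p) * pinner u (X p) (A p)) *\<^sub>R X p
      + (s * pinner u (Y p) (Y p) * pinner u (Y p) (A p)) *\<^sub>R Y p - s *\<^sub>R A p - s *\<^sub>R A p"
    unfolding nabla2_\<sigma>[OF X p] nabla2_\<sigma>[OF Y p]
    by (simp add: scaleR_diff_right mult.left_commute[of _ s] mult.assoc)
  ultimately show ?thesis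
    by simp
qed

text \<open>Not all tangential projections of the coordinate vectors are null: the squares of their
  lengths, with the signs of the metric, have the sum \<open>3 - 1\<close>.\<close>

lemma ex_orthonormal_at:
  assumes p: "p \<in> M"
  shows "\<exists>X Y. orthonormal_at u M p X Y"
proof -
  define E where "E i = (axis i 1 :: vec3)" for i
  have "\<exists>i. pinner u (tangent_projection p (E i)) (tangent_projection p (E i)) \<noteq> 0"
  proof (rule ccontr)
    assume "\<nexists>i. pinner u (tangent_projection p (E i)) (tangent_projection p (E i)) \<noteq> 0"
    then have 0: "pinner u (tangent_projection p (E i)) (tangent_projection p (E i)) = 0" for i
      by blast
    have row: "s * (pinner u (E i) (E i) * p $ i * p $ i) = 1" for i
    proof -
      define d where "d = pinner u (E i) (E i)"
      have d: "d * d = 1" "pinner u (E i) p = d * p $ i"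
        using exhaust_3[of i] by (auto simp: d_def E_def pinner_def axis_def)
      have "d - s * (d * p $ i) * (d * p $ i) = 0"
        using 0[of i] pinner_tangent_projection[OF p, of "E i"]
        by (simp add: tangent_projection_def[of p "E i"] pinner.diff_left pinner.diff_right
            pinner.scaleR_left pinner.scaleR_right pinner_commute[of u p "E i"] d flip: d_def)
      then have "d * (d - s * (d * p $ i) * (d * p $ i)) = 0"
        by simp
      then show ?thesis
        unfolding d_def[symmetric] using d(1) by algebra
    qed
    have "s * pinner u p p = 3"
      unfolding pinner_eq_sum[of u p p] sum_3 distrib_left using row by (simp add: E_def)
    then show False
      using pinner_self[OF p] ss by simp
  qed
  then obtain w where w: "pinner u p w = 0" "pinner u w w \<noteq> 0"
    using pinner_tangent_projection[OF p] by blast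
  define x where "x = (1 / sqrt \<bar>pinner u w w\<bar>) *\<^sub>R w"
  have xx: "pinner u x x = 1 \<or> pinner u x x = -1"
    using w(2) by (cases "pinner u w w > 0")
      (simp_all add: x_def pinner.scaleR_left pinner.scaleR_right)
  have px: "pinner u p x = 0"
    using w(1) by (simp add: x_def pinner.scaleR_right)
  obtain y where y: "pinner u y p = 0" "pinner u y x = 0" "pinner u y y = 1 \<or> pinner u y y = -1"
    using ex_orthonormal_completion[OF pinner_self[OF p] s_cases refl xx px] by blast
  obtain X where X: "vector_field M X" "X p = x"
    using p px by (rule ex_vector_field)
  have "pinner u p y = 0"
    using y(1) by (simp add: pinner_commute)
  with p obtain Y where Y: "vector_field M Y" "Y p = y"
    by (rule ex_vector_field)
  have "orthonormal_at u M p X Y"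
    using X Y xx y by (simp add: orthonormal_at_def pinner_commute[of u x y])
  then show ?thesis by blast
qed

lemma rough_laplacian_\<sigma>:
  assumes p: "p \<in> M"
  shows "rough_laplacian u M \<sigma> p = s *\<^sub>R \<sigma> p"
proof -
  have "trace_nabla2 u M \<sigma> p = - (s *\<^sub>R A p)"
    unfolding trace_nabla2_def
  proof (rule the_equality)
    show "\<exists>X Y. orthonormal_at u M p X Y \<and> - (s *\<^sub>R A p) = pinner u (X p) (X p) *\<^sub>R nabla2 u M X X \<sigma> p
          + pinner u (Y p) (Y p) *\<^sub>R nabla2 u M Y Y \<sigma> p"
      using ex_orthonormal_at[OF p] trace_term[OF _ p] by metis
  next
    fix w assume "\<exists>X Y. orthonormal_at u M p X Y \<and> w = pinner u (X p) (X p) *\<^sub>R nabla2 u M X X \<sigma> p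
          + pinner u (Y p) (Y p) *\<^sub>R nabla2 u M Y Y \<sigma> p"
    then show "w = - (s *\<^sub>R A p)"
      using trace_term[OF _ p] by metis
  qed
  then show ?thesis
    by (simp add: rough_laplacian_def \<sigma>_eq[OF p])
qed

text \<open>\<open>dF(v) = \<langle>A p, A v\<rangle> = \<langle>- A\<^sup>2 p, v\<rangle>\<close> by skew-symmetry, and only the tangential part of \<open>- A\<^sup>2 p\<close>
  matters.\<close>

lemma grad_eq:
  assumes p: "p \<in> M"
  shows "grad u M (\<lambda>q. 1/2 * pinner u (\<sigma> q) (\<sigma> q)) p = tangent_projection p (- A (A p))"
    (is "grad u M ?F p = ?g")
proof -
  have dF: "dM M ?F p v = pinner u ?g v" if v: "v \<in> tangent_space M p" for v
  proof -
    have dA: "dM M A p v = A v"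
      by (rule dM_eq[OF bounded_linear_imp_has_derivative[OF bounded_linear_A] v])
    have "dM M ?F p v = dM M (\<lambda>q. 1/2 * pinner u (A q) (A q)) p v"
      using p by (rule dM_cong) (simp add: \<sigma>_eq)
    also have "\<dots> = 1/2 * (pinner u (A p) (A v) + pinner u (A v) (A p))"
      using dM_bilinear[OF bounded_bilinear_mult smooth_fun_const[of M "1/2"]
          smooth_fun_pinner[OF smooth_A smooth_A] p v]
        dM_pinner[OF smooth_A smooth_A p v, of u]
      by (simp add: dM_const[OF v] dA)
    also have "\<dots> = pinner u (- A (A p)) v"
      using skew[of "A p" v] by (simp add: pinner.minus_left pinner_commute[of u "A v"])
    also have "\<dots> = pinner u ?g v"
      using v p by (simp add: tangent_projection_def tangent_space_eq pinner.diff_left pinner.scaleR_left)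
    finally show ?thesis .
  qed
  show ?thesis
    unfolding grad_def
  proof (rule the_equality)
    show "?g \<in> tangent_space M p \<and> (\<forall>v\<in>tangent_space M p. pinner u ?g v = dM M ?F p v)"
      using dF p by (simp add: tangent_space_eq pinner_tangent_projection)
  next
    fix w assume w: "w \<in> tangent_space M p \<and> (\<forall>v\<in>tangent_space M p. pinner u w v = dM M ?F p v)"
    have "w - ?g = 0"
    proof (rule tangent_nondegenerate[OF p])
      show "pinner u p (w - ?g) = 0"
        using w p by (simp add: tangent_space_eq pinner.diff_right pinner_tangent_projection)
      show "pinner u (w - ?g) v = 0" if "pinner u p v = 0" for v
        using w dF[of v] that p by (simp add: tangent_space_eq pinner.diff_left)
    qed
    then show "w = ?g" by simp
  qed
qed

text \<open>Both \<open>p\<close> and \<open>A\<^sup>2 p\<close> are orthogonal to \<open>A p\<close>, so the connection adds no normal correction here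
  and \<open>\<nabla>\<sigma>\<close> in the direction of the gradient is the plain image under \<open>A\<close>, a combination of \<open>A\<^sup>3 p\<close>
  and \<open>A p\<close>.\<close>

lemma nabla_grad_\<sigma>:
  assumes cube: "\<And>x. A (A (A x)) = l *\<^sub>R A x" and p: "p \<in> M"
  shows "nabla u M (grad u M (\<lambda>q. 1/2 * pinner u (\<sigma> q) (\<sigma> q))) \<sigma> p
    = (- l - s * pinner u (A p) (A p)) *\<^sub>R \<sigma> p"
proof -
  let ?G = "grad u M (\<lambda>q. 1/2 * pinner u (\<sigma> q) (\<sigma> q))"
  have "vector_field M (\<lambda>q. tangent_projection q (- A (A q)))"
    by (intro vector_field_projection smooth_fun_minus smooth_fun_linear_comp[OF bounded_linear_A]
        smooth_A)
  then have G: "vector_field M ?G"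
    by (rule vector_field_cong) (rule grad_eq)
  have g: "?G p = - A (A p) - (s * pinner u (A p) (A p)) *\<^sub>R p"
    unfolding grad_eq[OF p] using skew[of "A p" p]
    by (simp add: tangent_projection_def pinner.minus_left)
  have "A (?G p) = (- l - s * pinner u (A p) (A p)) *\<^sub>R A p"
    unfolding g
    by (simp add: linear_diff[OF linear_A] linear_neg[OF linear_A] linear_cmul[OF linear_A] cube
        scaleR_diff_left)
  moreover have "pinner u (?G p) (A p) = 0"
    unfolding g using skew_self[of "A p"] skew_self[of p]
    by (simp add: pinner.diff_left pinner.minus_left pinner.scaleR_left
        pinner_commute[of u "A (A p)"])
  ultimately show ?thesis
    using nabla_\<sigma>[OF G p] by (simp add: \<sigma>_eq[OF p])
qed

lemma preharmonic_\<sigma>: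
  assumes "\<And>x. A (A (A x)) = l *\<^sub>R A x"
  shows "preharmonic u M \<sigma>"
  unfolding preharmonic_def Let_def
proof (intro conjI exI ballI)
  show "smooth_fun M (\<lambda>p. s)"
    by (rule smooth_fun_const)
  show "smooth_fun M (\<lambda>p. - l - s * pinner u (A p) (A p))"
    by (intro smooth_fun_intros smooth_A)
qed (simp_all add: vector_field_\<sigma> rough_laplacian_\<sigma> nabla_grad_\<sigma>[OF assms, simplified])

end

text \<open>This is the Cayley--Hamilton theorem: a skew-symmetric map of a three-dimensional space has
  trace and determinant zero, so its characteristic polynomial is \<open>t\<^sup>3 - \<lambda> t\<close>.\<close>

lemma skew_matrix_cube:
  fixes a b c :: real
  assumes A: "linear A" and e: "orthonormal_frame u e"
    and "\<epsilon>\<^sub>1 = pinner u (e 1) (e 1)" and "\<epsilon>\<^sub>2 = pinner u (e 2) (e 2)" and "\<epsilon>\<^sub>3 = pinner u (e 3) (e 3)"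
    and N: "has_matrix e A
           (vector [vector [0, a, b],
                    vector [- \<epsilon>\<^sub>1 * \<epsilon>\<^sub>2 * a, 0, c],
                    vector [- \<epsilon>\<^sub>1 * \<epsilon>\<^sub>3 * b, - \<epsilon>\<^sub>2 * \<epsilon>\<^sub>3 * c, 0]])"
  shows "A (A (A x)) = (- \<epsilon>\<^sub>1 * \<epsilon>\<^sub>2 * a^2 - \<epsilon>\<^sub>1 * \<epsilon>\<^sub>3 * b^2 - \<epsilon>\<^sub>2 * \<epsilon>\<^sub>3 * c^2) *\<^sub>R A x"
    (is "_ = ?l *\<^sub>R A x")
proof -
  interpret A: linear A by (rule A)
  have sq: "\<epsilon>\<^sub>1 * \<epsilon>\<^sub>1 = 1" "\<epsilon>\<^sub>2 * \<epsilon>\<^sub>2 = 1" "\<epsilon>\<^sub>3 * \<epsilon>\<^sub>3 = 1"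
    using orthonormal_frame_sign_square[OF e] assms(3-5) by auto
  have Ae: "A (e 1) = (- \<epsilon>\<^sub>1 * \<epsilon>\<^sub>2 * a) *\<^sub>R e 2 + (- \<epsilon>\<^sub>1 * \<epsilon>\<^sub>3 * b) *\<^sub>R e 3"
    "A (e 2) = a *\<^sub>R e 1 + (- \<epsilon>\<^sub>2 * \<epsilon>\<^sub>3 * c) *\<^sub>R e 3"
    "A (e 3) = b *\<^sub>R e 1 + c *\<^sub>R e 2"
    using N by (simp_all add: has_matrix_def sum_3)
  have A_comb: "A (x *\<^sub>R e 1 + y *\<^sub>R e 2 + z *\<^sub>R e 3)
      = (a * y + b * z) *\<^sub>R e 1 + (- \<epsilon>\<^sub>1 * \<epsilon>\<^sub>2 * a * x + c * z) *\<^sub>R e 2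
        + (- \<epsilon>\<^sub>1 * \<epsilon>\<^sub>3 * b * x - \<epsilon>\<^sub>2 * \<epsilon>\<^sub>3 * c * y) *\<^sub>R e 3" for x y z
    by (simp add: A.add A.scaleR Ae algebra_simps)
  obtain x1 x2 x3 where x: "x = x1 *\<^sub>R e 1 + x2 *\<^sub>R e 2 + x3 *\<^sub>R e 3"
    using orthonormal_frame_expansion[OF e, of x] unfolding sum_3 by blast
  have coeff: "u *\<^sub>R e 1 + v *\<^sub>R e 2 + w *\<^sub>R e 3 = l *\<^sub>R (u' *\<^sub>R e 1 + v' *\<^sub>R e 2 + w' *\<^sub>R e 3)"
    if "u = l * u'" "v = l * v'" "w = l * w'" for u v w u' v' w' l
    using that by (simp add: scaleR_add_right)
  show ?thesis
    unfolding x A_comb by (rule coeff; use sq in algebra)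
qed

section \<open>Killing fields on two-dimensional quadrics are preharmonic\<close>

theorem lemma7p1:
  fixes u :: nat and M :: "vec3 set"
    and \<sigma> A :: "vec3 \<Rightarrow> vec3" and e :: "3 \<Rightarrow> vec3"
    and a b c \<epsilon>\<^sub>1 \<epsilon>\<^sub>2 \<epsilon>\<^sub>3 :: real
  assumes "quadric u M"
    and "killing_field u M \<sigma>"
    and "linear_extension u M \<sigma> A"
    and "orthonormal_frame u e"
    and "\<epsilon>\<^sub>1 = pinner u (e 1) (e 1)"
    and "\<epsilon>\<^sub>2 = pinner u (e 2) (e 2)"
    and "\<epsilon>\<^sub>3 = pinner u (e 3) (e 3)"
    and "has_matrix e A
           (vector [vector [0, a, b],
                    vector [- \<epsilon>\<^sub>1 * \<epsilon>\<^sub>2 * a, 0, c],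
                    vector [- \<epsilon>\<^sub>1 * \<epsilon>\<^sub>3 * b, - \<epsilon>\<^sub>2 * \<epsilon>\<^sub>3 * c, 0]])"
  shows "preharmonic u M \<sigma> \<and>
         (\<forall>x\<in>M. hat_field u M \<sigma> x =
            (- \<epsilon>\<^sub>1 * \<epsilon>\<^sub>2 * a^2 - \<epsilon>\<^sub>1 * \<epsilon>\<^sub>3 * b^2 - \<epsilon>\<^sub>2 * \<epsilon>\<^sub>3 * c^2) *\<^sub>R \<sigma> x)"
proof -
  obtain s where "nondegenerate_quadric u s M"
    using quadric_nondegenerate[OF assms(1)] by blast
  then interpret linear_killing_field u s M \<sigma> A
    using assms(3) by (simp add: linear_killing_field_def linear_killing_field_axioms_def)
  note cube = skew_matrix_cube[OF linear_A assms(4-8)]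
  show ?thesis
    using preharmonic_\<sigma>[OF cube] by (simp add: hat_field_eq \<sigma>_eq cube)
qed

end
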